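(* Let $\theta_1=\phi_1(D)$ and $\theta_2=\phi_2(D)$ be delta operators with poweroids $x^{\{n\}_1}$ and $x^{\{n\}_2}$ respectively, let $\eta_1=\phi_1^{-1}(D)$, $\eta_2=\phi_2^{-1}(D)$, and let $x^{\{n\}_{12}}$ be the poweroids of the composite delta operator $\phi_{12}(D)=(\phi_2\circ\phi_1)(D)=\phi_2(\phi_1(D))$. Then $$e^{x\,\phi_1^{-1}(\eta_2)}=e^{x\eta_1}\,e^{0_1\cdot\eta_2},$$ and, for every integer $n\ge0$, $$x^{\{n\}_{12}}=e^{x\eta_1}\,e^{0_1\cdot\eta_2}\,0_2^n=e^{x\eta_1}\,0_1^{\{n\}_2}=x^{\{n\}_2}\Big|_{x^i\to x^{\{i\}_1}},$$ i.e. $x^{\{n\}_{12}}$ is obtained from the polynomial $x^{\{n\}_2}$ by replacing each power $x^i$ by the poweroid $x^{\{i\}_1}$.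
   Context: Work with polynomials in one variable (real or complex coefficients); $D$ is differentiation. A delta operator is $\theta=\phi(D)$, where $\phi(t)=\sum_{\nu\ge1}k_\nu t^\nu$ is a formal power series with $k_1=1$; $\phi^{-1}$ is its compositional inverse. The poweroids $x^{\{n\}}$ of $\theta$ are the unique polynomials with $x^{\{0\}}=1$, $\theta x^{\{n\}}=n\,x^{\{n-1\}}$ for $n\ge1$, and $x^{\{n\}}|_{x=0}=0$ for $n\ge1$. For a formal power series $f$ and polynomial $h$, $f(D)h(0)$ denotes $(f(D_z)h(z))|_{z=0}$; in $e^{x\eta}0^n$ the operator $\eta$ acts on $z^n$, then $z=0$, with $x$ a parameter. The symbols $0_1,0_2$ are two independent such variables (set to $0$ after the operators act): $\eta_1$ acts on powers of $0_1$ and $\eta_2$ acts on powers of $0_2$. Thus $e^{x\eta_1}e^{0_1\cdot\eta_2}$ is the power series in $\eta_2$ given by $\sum_{\nu\ge0}\big(e^{x\eta_1}0_1^\nu\big)\,\eta_2^\nu/\nu!$, and $e^{x\eta_1}0_1^{\{n\}_2}=\big(e^{x\phi_1^{-1}(D_z)}z^{\{n\}_2}\big)|_{z=0}$. *)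

theory Defs
  imports "HOL-Computational_Algebra.Computational_Algebra"
begin

definition delta_series :: "'a::field_char_0 fps \<Rightarrow> bool" where
  "delta_series \<phi> \<longleftrightarrow> fps_nth \<phi> 0 = 0 \<and> fps_nth \<phi> 1 = 1"

text \<open>
  The operator f(T), for a linear operator T that lowers degrees and kills constants: then
  T^i h = 0 for all i > degree h, so that the truncation below loses nothing
  (see \<open>funpow_degree_lowering_eq_0\<close>). For other T the value is junk. The operators T used
  below are all of the form g(D) with g(0) = 0, where D = \<open>pderiv\<close>.
\<close>
definition fps_op :: "'a::field_char_0 fps \<Rightarrow> ('a poly \<Rightarrow> 'a poly) \<Rightarrow> 'a poly \<Rightarrow> 'a poly" where
  "fps_op f T h = (\<Sum>i\<le>degree h. smult (fps_nth f i) ((T ^^ i) h))"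

definition is_poweroids :: "('a::field_char_0 poly \<Rightarrow> 'a poly) \<Rightarrow> (nat \<Rightarrow> 'a poly) \<Rightarrow> bool" where
  "is_poweroids \<theta> p \<longleftrightarrow> p 0 = 1 \<and>
     (\<forall>n\<ge>1. \<theta> (p n) = smult (of_nat n) (p (n - 1)) \<and> poly (p n) 0 = 0)"

text \<open>Well-defined for delta operators by \<open>ex1_poweroids\<close> below.\<close>
definition poweroid :: "('a::field_char_0 poly \<Rightarrow> 'a poly) \<Rightarrow> nat \<Rightarrow> 'a poly" where
  "poweroid \<theta> = (THE p. is_poweroids \<theta> p)"

text \<open>The value at z = 0 of \<open>e^(x \<eta>) h(z)\<close>, where \<open>\<eta>\<close> acts in the variable z.\<close>
definition exp_at_0 :: "'a::field_char_0 \<Rightarrow> ('a poly \<Rightarrow> 'a poly) \<Rightarrow> 'a poly \<Rightarrow> 'a" where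
  "exp_at_0 x \<eta> h = poly (fps_op (fps_exp x) \<eta> h) 0"

text \<open>The operator \<open>e^(x \<eta>\<^sub>1) e^(0\<^sub>1 \<eta>\<^sub>2)\<close>, a power series in \<open>\<eta>\<^sub>2\<close>
  whose coefficients come from letting \<open>\<eta>\<^sub>1\<close> act on the powers of \<open>0\<^sub>1\<close>.\<close>
definition exp_exp_op ::
  "'a::field_char_0 \<Rightarrow> ('a poly \<Rightarrow> 'a poly) \<Rightarrow> ('a poly \<Rightarrow> 'a poly) \<Rightarrow> 'a poly \<Rightarrow> 'a poly" where
  "exp_exp_op x \<eta>1 \<eta>2 =
     fps_op (Abs_fps (\<lambda>\<nu>. exp_at_0 x \<eta>1 (monom 1 \<nu>) / fact \<nu>)) \<eta>2"

text \<open>Replace each power \<open>x^i\<close> in h by the polynomial \<open>p i\<close>.\<close>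
definition umbral_subst :: "'a::field_char_0 poly \<Rightarrow> (nat \<Rightarrow> 'a poly) \<Rightarrow> 'a poly" where
  "umbral_subst h p = (\<Sum>i\<le>degree h. smult (coeff h i) (p i))"


lemma degree_funpow_pderiv: "degree ((pderiv ^^ i) (h::'a::field_char_0 poly)) = degree h - i"
  by (induction i) (auto simp: degree_pderiv)

lemma funpow_pderiv_eq_0:
  "i > degree h \<Longrightarrow> (pderiv ^^ i) (h::'a::field_char_0 poly) = 0"
proof (induction i)
  case (Suc i)
  have "degree ((pderiv ^^ i) h) = 0"
    using Suc.prems by (simp add: degree_funpow_pderiv)
  then show ?case by (simp add: pderiv_eq_0_iff)
qed simp

lemma fps_op_pderiv_eq:
  assumes "degree h \<le> N"
  shows "fps_op f pderiv h = (\<Sum>i\<le>N. smult (fps_nth f i) ((pderiv ^^ i) h))"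
  unfolding fps_op_def using assms
  by (intro sum.mono_neutral_left) (auto simp: funpow_pderiv_eq_0)

lemma funpow_pderiv_add: "(pderiv ^^ i) (p + q) = (pderiv ^^ i) p + (pderiv ^^ i) q"
  by (induction i) (auto simp: pderiv_add)

lemma funpow_pderiv_smult: "(pderiv ^^ i) (smult c p) = smult c ((pderiv ^^ i) p)"
  by (induction i) (auto simp: pderiv_smult)

lemma fps_op_pderiv_add:
  "fps_op f pderiv (p + q) = fps_op f pderiv p + fps_op f pderiv q"
proof -
  define N where "N = max (degree p) (degree q)"
  have "degree p \<le> N" "degree q \<le> N" "degree (p + q) \<le> N"
    by (auto simp: N_def degree_add_le)
  then show ?thesis
    by (simp add: fps_op_pderiv_eq[where N = N] funpow_pderiv_add smult_add_right sum.distrib)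
qed

lemma fps_op_pderiv_smult: "fps_op f pderiv (smult c p) = smult c (fps_op f pderiv p)"
  by (rule poly_eqI) (simp add: fps_op_pderiv_eq[where N = "degree p"] funpow_pderiv_smult
    coeff_sum sum_distrib_left mult_ac)

lemma fps_op_pderiv_0 [simp]: "fps_op f pderiv 0 = 0"
  by (simp add: fps_op_def)

lemma fps_op_pderiv_diff:
  "fps_op f pderiv (p - q) = fps_op f pderiv p - fps_op f pderiv q"
  using fps_op_pderiv_add[of f "p - q" q] by simp

lemma fps_op_pderiv_const: "fps_nth f 0 = 0 \<Longrightarrow> degree h = 0 \<Longrightarrow> fps_op f pderiv h = 0"
  by (simp add: fps_op_def)

lemma degree_fps_op_pderiv:
  assumes "fps_nth f 0 = 0"
  shows "degree (fps_op f pderiv h) \<le> degree h - 1"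
  unfolding fps_op_def
proof (rule degree_sum_le)
  fix i assume "i \<in> {..degree h}"
  show "degree (smult (fps_nth f i) ((pderiv ^^ i) h)) \<le> degree h - 1"
    using assms by (cases i) (auto simp: degree_funpow_pderiv simp del: funpow.simps)
qed simp

lemma funpow_degree_lowering_eq_0:
  fixes T :: "'a::field_char_0 poly \<Rightarrow> 'a poly"
  assumes lower: "\<And>h. degree (T h) \<le> degree h - 1" and const: "\<And>h. degree h = 0 \<Longrightarrow> T h = 0"
    and "i > degree h"
  shows "(T ^^ i) h = 0"
proof -
  have deg: "degree ((T ^^ j) h) \<le> degree h - j" for j
  proof (induction j)
    case (Suc j)
    then show ?case using lower[of "(T ^^ j) h"] by simp
  qed simp
  obtain j where j: "i = Suc j" "degree h \<le> j" using assms(3) by (cases i) auto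
  then show ?thesis using deg[of j] by (simp add: const)
qed

lemma funpow_fps_op_pderiv_eq_0:
  assumes "fps_nth f 0 = 0" "i > degree h"
  shows "(fps_op f pderiv ^^ i) h = 0"
  using assms by (intro funpow_degree_lowering_eq_0 degree_fps_op_pderiv fps_op_pderiv_const)

lemma coeff_fps_op_delta:
  assumes "delta_series \<phi>" "degree h \<le> Suc n"
  shows "coeff (fps_op \<phi> pderiv h) n = of_nat (Suc n) * coeff h (Suc n)"
proof -
  have *: "coeff ((pderiv ^^ i) h) n = 0" if "i \<ge> 2" for i
    using that assms(2) degree_funpow_pderiv[of i h] funpow_pderiv_eq_0[of h i]
    by (cases "i > degree h") (auto intro: coeff_eq_0)
  have "coeff (fps_op \<phi> pderiv h) n = (\<Sum>i\<le>Suc n. fps_nth \<phi> i * coeff ((pderiv ^^ i) h) n)"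
    by (simp add: fps_op_pderiv_eq[OF assms(2)] coeff_sum del: sum.atMost_Suc)
  also have "\<dots> = (\<Sum>i\<in>{1}. fps_nth \<phi> i * coeff ((pderiv ^^ i) h) n)"
  proof (rule sum.mono_neutral_right)
    show "\<forall>i\<in>{..Suc n} - {1}. fps_nth \<phi> i * coeff ((pderiv ^^ i) h) n = 0"
    proof
      fix i assume "i \<in> {..Suc n} - {1}"
      then have "i = 0 \<or> i \<ge> 2" by auto
      then show "fps_nth \<phi> i * coeff ((pderiv ^^ i) h) n = 0"
        using * assms(1) by (auto simp: delta_series_def)
    qed
  qed auto
  finally show ?thesis using assms(1) by (simp add: delta_series_def coeff_pderiv)
qed

lemma fps_op_delta_eq_0_imp:
  assumes "delta_series \<phi>" "fps_op \<phi> pderiv h = 0"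
  shows "degree h = 0"
proof (rule ccontr)
  assume "degree h \<noteq> 0"
  then obtain n where n: "degree h = Suc n" by (cases "degree h") auto
  have "of_nat (Suc n) * coeff h (Suc n) = 0"
    using coeff_fps_op_delta[OF assms(1), of h n] n assms(2) by simp
  then show False using n by (metis leading_coeff_0_iff mult_eq_0_iff of_nat_neq_0 degree_0 nat.distinct(1))
qed

lemma fps_op_delta_surj:
  assumes "delta_series \<phi>" "degree q < n"
  shows "\<exists>p. fps_op \<phi> pderiv p = q \<and> poly p 0 = 0"
  using assms(2)
proof (induction n arbitrary: q)
  case (Suc n)
  define r where "r = monom (coeff q n / of_nat (Suc n)) (Suc n)"
  define q' where "q' = q - fps_op \<phi> pderiv r"
  have degr: "degree r \<le> Suc n" unfolding r_def by (rule degree_monom_le)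
  have d: "degree (fps_op \<phi> pderiv r) \<le> n"
    using degree_fps_op_pderiv[of \<phi> r] assms(1) degr by (simp add: delta_series_def)
  have "coeff (fps_op \<phi> pderiv r) n = coeff q n"
    using coeff_fps_op_delta[OF assms(1) degr] by (simp add: r_def del: of_nat_Suc)
  then have c: "coeff q' n = 0" unfolding q'_def by (simp del: of_nat_Suc)
  have dq: "degree q' \<le> n" unfolding q'_def using Suc.prems d by (intro degree_diff_le) auto
  have "\<exists>p. fps_op \<phi> pderiv p = q' \<and> poly p 0 = 0"
  proof (cases "q' = 0")
    case True
    then show ?thesis by (intro exI[of _ 0]) simp
  next
    case False
    then have "degree q' < n" using dq c by (metis le_neq_implies_less leading_coeff_0_iff)
    then show ?thesis by (rule Suc.IH)
  qed
  then obtain p where "fps_op \<phi> pderiv p = q'" "poly p 0 = 0" by blast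
  then show ?case
    by (intro exI[of _ "p + r"]) (auto simp: fps_op_pderiv_add q'_def r_def poly_monom)
qed simp

lemma ex1_poweroids:
  assumes "delta_series \<phi>"
  shows "\<exists>!p. is_poweroids (fps_op \<phi> pderiv) p"
proof (rule ex_ex1I)
  define step where "step n q = (SOME p. fps_op \<phi> pderiv p = smult (of_nat (Suc n)) q \<and> poly p 0 = 0)"
    for n q
  have step: "fps_op \<phi> pderiv (step n q) = smult (of_nat (Suc n)) q \<and> poly (step n q) 0 = 0" for n q
    unfolding step_def by (rule someI_ex) (rule fps_op_delta_surj[OF assms lessI])
  have "is_poweroids (fps_op \<phi> pderiv) (rec_nat 1 step)"
    unfolding is_poweroids_def
  proof (intro conjI allI impI)
    fix n :: nat assume "n \<ge> 1"
    then obtain m where "n = Suc m" by (cases n) auto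
    then show "fps_op \<phi> pderiv (rec_nat 1 step n) = smult (of_nat n) (rec_nat 1 step (n - 1))"
      and "poly (rec_nat 1 step n) 0 = 0"
      using step by simp_all
  qed simp
  then show "\<exists>p. is_poweroids (fps_op \<phi> pderiv) p" by blast
next
  fix a b
  assume ab: "is_poweroids (fps_op \<phi> pderiv) a" "is_poweroids (fps_op \<phi> pderiv) b"
  have "a n = b n" for n
  proof (induction n)
    case 0
    then show ?case using ab by (simp add: is_poweroids_def)
  next
    case (Suc n)
    have "fps_op \<phi> pderiv (a (Suc n) - b (Suc n)) = 0" "poly (a (Suc n) - b (Suc n)) 0 = 0"
      using ab Suc by (auto simp: is_poweroids_def fps_op_pderiv_diff)
    then show ?case using fps_op_delta_eq_0_imp[OF assms]
      by (metis degree_eq_zeroE poly_const_conv eq_iff_diff_eq_0 pCons_0_0)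
  qed
  then show "a = b" by blast
qed

lemma is_poweroids_poweroid:
  "delta_series \<phi> \<Longrightarrow> is_poweroids (fps_op \<phi> pderiv) (poweroid (fps_op \<phi> pderiv))"
  unfolding poweroid_def by (rule theI'[OF ex1_poweroids])

lemma delta_series_compose:
  assumes "delta_series \<phi>1" "delta_series \<phi>2"
  shows "delta_series (\<phi>2 oo \<phi>1)"
  using assms by (simp add: delta_series_def fps_compose_nth)

end

(*
  Writing psi for the compositional inverse of phi, the poweroids are explicit: the coefficient of
  x^k in x^{n} is n!/k! times the n-th coefficient of psi^k. Equivalently, x^{n} is n! times the
  n-th coefficient of exp(x psi), which is e^(x eta) 0^n since f(D) z^n at z = 0 is n! f_n.
  As f(D) is multiplicative in f, substituting psi_2(D) into a power series f gives
  (f o psi_2)(D), and all identities reduce to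
  (phi_2 o phi_1)^(-1) = psi_1 o psi_2 and associativity of composition.
*)
theory Submission imports Defs begin

lemma smult_sum_right: "smult c (sum f A) = (\<Sum>i\<in>A. smult c (f i))"
  by (induction A rule: infinite_finite_induct) (simp_all add: smult_add_right)

text \<open>Both sides are sums of \<open>t i j\<close>, over a triangle on the left and a square on
  the right. The two agree because \<open>pderiv\<close> iterated more than \<open>degree h\<close>
  times kills \<open>h\<close>.\<close>

lemma fps_op_pderiv_mult:
  "fps_op (f * g) pderiv h = fps_op f pderiv (fps_op g pderiv h)"
proof -
  define N where "N = degree h"
  define t where "t i j = smult (fps_nth f i * fps_nth g j) ((pderiv ^^ (i + j)) h)" for i j
  have "degree (fps_op g pderiv h) \<le> N"
    unfolding fps_op_def N_def by (rule degree_sum_le) (auto simp: degree_funpow_pderiv)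
  then have "fps_op f pderiv (fps_op g pderiv h) =
      (\<Sum>i\<le>N. smult (fps_nth f i) ((pderiv ^^ i) (fps_op g pderiv h)))"
    by (rule fps_op_pderiv_eq)
  also have "\<dots> = (\<Sum>i\<le>N. \<Sum>j\<le>N. t i j)"
    by (simp add: fps_op_pderiv_eq[of h N g] N_def t_def higher_pderiv_sum funpow_pderiv_smult
        smult_sum_right funpow_add)
  also have "\<dots> = (\<Sum>(i, j)\<in>{..N} \<times> {..N}. t i j)"
    by (simp add: sum.cartesian_product)
  also have "\<dots> = (\<Sum>(i, j)\<in>{(i, j). i + j \<le> N}. t i j)"
    using funpow_pderiv_eq_0[of h]
    by (intro sum.mono_neutral_right) (auto simp: t_def N_def intro: leI)
  also have "\<dots> = (\<Sum>k\<le>N. \<Sum>i\<le>k. t i (k - i))"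
    by (rule sum.triangle_reindex_eq)
  also have "\<dots> = (\<Sum>k\<le>N. smult (fps_nth (f * g) k) ((pderiv ^^ k) h))"
    by (simp add: t_def fps_mult_nth smult_sum atLeast0AtMost)
  also have "\<dots> = fps_op (f * g) pderiv h"
    by (simp add: fps_op_def N_def)
  finally show ?thesis by simp
qed

lemma funpow_fps_op_pderiv: "(fps_op g pderiv ^^ i) h = fps_op (g ^ i) pderiv h"
proof (induction i)
  case 0
  have "fps_op 1 pderiv h = (\<Sum>i\<le>degree h. if i = 0 then h else 0)"
    unfolding fps_op_def by (intro sum.cong) auto
  then show ?case by simp
qed (simp add: fps_op_pderiv_mult)

text \<open>Iterates of g(D) are the operators of the powers of g, so the claim is an exchange of
  sums. As g(0) = 0, the power \<open>g ^ i\<close> has order at least i, so cutting off at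
  \<open>degree h\<close> loses no part of a coefficient of \<open>f oo g\<close> that acts on
  \<open>h\<close>.\<close>

lemma fps_op_fps_op_pderiv:
  fixes f g :: "'a::field_char_0 fps"
  assumes "fps_nth g 0 = 0"
  shows "fps_op f (fps_op g pderiv) = fps_op (f oo g) pderiv"
proof
  fix h :: "'a poly"
  define N where "N = degree h"
  have "fps_op f (fps_op g pderiv) h =
      (\<Sum>i\<le>N. \<Sum>j\<le>N. smult (fps_nth f i * fps_nth (g ^ i) j) ((pderiv ^^ j) h))"
    unfolding fps_op_def[of f] funpow_fps_op_pderiv by (simp add: N_def fps_op_def smult_sum_right)
  also have "\<dots> = (\<Sum>j\<le>N. smult (\<Sum>i\<le>N. fps_nth f i * fps_nth (g ^ i) j) ((pderiv ^^ j) h))"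
    by (subst sum.swap) (simp add: smult_sum)
  also have "\<dots> = (\<Sum>j\<le>N. smult (fps_nth (f oo g) j) ((pderiv ^^ j) h))"
  proof (rule sum.cong)
    fix j assume "j \<in> {..N}"
    then have "(\<Sum>i\<le>N. fps_nth f i * fps_nth (g ^ i) j) = fps_nth (f oo g) j"
      unfolding fps_compose_nth using startsby_zero_power_prefix[OF assms]
      by (intro sum.mono_neutral_right) auto
    then show "smult (\<Sum>i\<le>N. fps_nth f i * fps_nth (g ^ i) j) ((pderiv ^^ j) h) =
        smult (fps_nth (f oo g) j) ((pderiv ^^ j) h)" by simp
  qed simp
  also have "\<dots> = fps_op (f oo g) pderiv h" by (simp add: fps_op_def N_def)
  finally show "fps_op f (fps_op g pderiv) h = fps_op (f oo g) pderiv h" .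
qed

lemma coeff_funpow_pderiv:
  "coeff ((pderiv ^^ i) h) n = fact (n + i) / fact n * coeff (h :: 'a::field_char_0 poly) (n + i)"
proof (induction i arbitrary: n)
  case (Suc i)
  have "(fact (Suc n) :: 'a) = of_nat (Suc n) * fact n" by (rule fact_Suc)
  then show ?case by (simp add: coeff_pderiv Suc.IH del: of_nat_Suc fact_Suc)
qed simp

text \<open>Only constant coefficients survive at 0, and that of the i-th derivative is i! times the
  i-th coefficient of \<open>h\<close>.\<close>

lemma poly_fps_op_pderiv_0:
  "poly (fps_op f pderiv h) 0 = (\<Sum>i\<le>degree h. fps_nth f i * (fact i * coeff h i))"
  by (simp add: fps_op_def poly_0_coeff_0 coeff_sum coeff_funpow_pderiv)

lemma poly_fps_op_pderiv_monom_0: "poly (fps_op f pderiv (monom 1 n)) 0 = fact n * fps_nth f n"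
proof -
  have "poly (fps_op f pderiv (monom 1 n)) 0 = (\<Sum>i\<le>n. if i = n then fact n * fps_nth f n else 0)"
    unfolding poly_fps_op_pderiv_0 by (intro sum.cong) (auto simp: degree_monom_eq)
  then show ?thesis by simp
qed

lemma exp_at_0_fps_op_pderiv:
  "fps_nth \<psi> 0 = 0 \<Longrightarrow>
    exp_at_0 x (fps_op \<psi> pderiv) h = poly (fps_op (fps_exp x oo \<psi>) pderiv h) 0"
  by (simp add: exp_at_0_def fps_op_fps_op_pderiv)

text \<open>Pairing with the monomials and dividing by the factorials recovers a series from its
  operator, so the series in \<eta>2 is \<open>fps_exp x oo \<psi>1\<close>.\<close>

lemma exp_exp_op_fps_op_pderiv:
  assumes "fps_nth \<psi>1 0 = 0" "fps_nth \<psi>2 0 = 0"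
  shows "exp_exp_op x (fps_op \<psi>1 pderiv) (fps_op \<psi>2 pderiv) =
    fps_op ((fps_exp x oo \<psi>1) oo \<psi>2) pderiv"
proof -
  have "Abs_fps (\<lambda>\<nu>. exp_at_0 x (fps_op \<psi>1 pderiv) (monom 1 \<nu>) / fact \<nu>) = fps_exp x oo \<psi>1"
    by (rule fps_ext) (simp add: exp_at_0_fps_op_pderiv[OF assms(1)] poly_fps_op_pderiv_monom_0)
  then show ?thesis
    by (simp add: exp_exp_op_def fps_op_fps_op_pderiv[OF assms(2)])
qed

text \<open>For \<psi> = log(1 + t) these are the falling factorials, with the signed Stirling
  numbers of the first kind as coefficients.\<close>

definition explicit_poweroid :: "'a::field_char_0 fps \<Rightarrow> nat \<Rightarrow> 'a poly" where
  "explicit_poweroid \<psi> n = (\<Sum>k\<le>n. monom (fact n / fact k * fps_nth (\<psi> ^ k) n) k)"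

text \<open>No bound on k is imposed: for k > n both sides vanish, since \<open>\<psi> ^ k\<close>
  has order at least k.\<close>

lemma coeff_explicit_poweroid:
  assumes "fps_nth \<psi> 0 = 0"
  shows "coeff (explicit_poweroid \<psi> n) k = fact n / fact k * fps_nth (\<psi> ^ k) n"
proof -
  have "coeff (explicit_poweroid \<psi> n) k =
      (\<Sum>j\<le>n. if j = k then fact n / fact k * fps_nth (\<psi> ^ k) n else 0)"
    unfolding explicit_poweroid_def coeff_sum by (intro sum.cong) auto
  then show ?thesis using startsby_zero_power_prefix[OF assms, of k] by auto
qed

lemma degree_explicit_poweroid: "degree (explicit_poweroid \<psi> n) \<le> n"
  unfolding explicit_poweroid_def
  by (rule degree_sum_le) (auto intro: order_trans[OF degree_monom_le])

lemma poly_explicit_poweroid: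
  "poly (explicit_poweroid \<psi> n) x = fact n * fps_nth (fps_exp x oo \<psi>) n"
  by (simp add: explicit_poweroid_def poly_sum poly_monom fps_compose_nth sum_distrib_left
      atLeast0AtMost mult_ac)

text \<open>Applying \<phi>(D) multiplies the series \<open>\<psi> ^ k\<close> behind the
  coefficient of x^k by \<open>\<phi> oo \<psi>\<close>, which is t. This shifts the index from n to
  n - 1, and n! = n (n - 1)! supplies the factor n.\<close>

lemma is_poweroids_explicit:
  assumes "fps_nth \<psi> 0 = 0" and inv: "\<phi> oo \<psi> = fps_X"
  shows "is_poweroids (fps_op \<phi> pderiv) (explicit_poweroid \<psi>)"
  unfolding is_poweroids_def
proof (intro conjI allI impI)
  show "explicit_poweroid \<psi> 0 = 1" by (simp add: explicit_poweroid_def)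
next
  fix n :: nat assume "n \<ge> 1"
  then obtain m where n: "n = Suc m" by (cases n) auto
  show "poly (explicit_poweroid \<psi> n) 0 = 0"
    using n by (simp add: poly_0_coeff_0 coeff_explicit_poweroid[OF assms(1)])
  show "fps_op \<phi> pderiv (explicit_poweroid \<psi> n) = smult (of_nat n) (explicit_poweroid \<psi> (n - 1))"
  proof (rule poly_eqI)
    fix k
    have "coeff (fps_op \<phi> pderiv (explicit_poweroid \<psi> n)) k =
        (\<Sum>i\<le>n. fact n / fact k * (fps_nth \<phi> i * fps_nth (\<psi> ^ (k + i)) n))"
      by (simp add: fps_op_pderiv_eq[OF degree_explicit_poweroid] coeff_sum coeff_funpow_pderiv
          coeff_explicit_poweroid[OF assms(1)] mult_ac)
    also have "\<dots> = fact n / fact k * (\<Sum>i\<le>n. fps_nth \<phi> i * fps_nth (\<psi> ^ (k + i)) n)"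
      by (simp add: sum_distrib_left)
    \<comment> \<open>The shift j = k + i is absorbed into the factor \<open>fps_X ^ k\<close>,
      which gives the summand the form of a composition coefficient.\<close>
    also have "(\<Sum>i\<le>n. fps_nth \<phi> i * fps_nth (\<psi> ^ (k + i)) n) =
        (\<Sum>j\<in>{k..n + k}. fps_nth (fps_X ^ k * \<phi>) j * fps_nth (\<psi> ^ j) n)"
      by (rule sum.reindex_bij_witness[of _ "\<lambda>j. j - k" "\<lambda>i. k + i"])
        (auto simp: fps_X_power_mult_nth)
    \<comment> \<open>Terms with j < k vanish through \<open>fps_X ^ k\<close>, those with j > n
      through the order of \<open>\<psi> ^ j\<close>.\<close>
    also have "\<dots> = (\<Sum>j\<in>{0..n}. fps_nth (fps_X ^ k * \<phi>) j * fps_nth (\<psi> ^ j) n)"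
      using startsby_zero_power_prefix[OF assms(1)]
      by (intro sum.mono_neutral_cong) (auto simp: fps_X_power_mult_nth)
    also have "\<dots> = fps_nth ((fps_X ^ k * \<phi>) oo \<psi>) n"
      by (simp add: fps_compose_nth)
    also have "(fps_X ^ k * \<phi>) oo \<psi> = \<psi> ^ k * fps_X"
      by (simp add: fps_compose_mult_distrib[OF assms(1)] fps_X_power_compose[OF assms(1)] inv)
    finally show "coeff (fps_op \<phi> pderiv (explicit_poweroid \<psi> n)) k =
        coeff (smult (of_nat n) (explicit_poweroid \<psi> (n - 1))) k"
      by (simp add: n coeff_explicit_poweroid[OF assms(1)])
  qed
qed

lemma poweroid_eq_explicit:
  assumes "delta_series \<phi>" "fps_nth \<psi> 0 = 0" "\<phi> oo \<psi> = fps_X"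
  shows "poweroid (fps_op \<phi> pderiv) = explicit_poweroid \<psi>"
  using ex1_poweroids[OF assms(1)] is_poweroids_poweroid[OF assms(1)]
    is_poweroids_explicit[OF assms(2,3)] by blast

theorem mainTheorem4:
  fixes \<phi>1 \<phi>2 :: "'a::field_char_0 fps"
    and \<theta>1 \<theta>2 \<theta>12 \<eta>1 \<eta>2 :: "'a poly \<Rightarrow> 'a poly"
  assumes "delta_series \<phi>1" and "delta_series \<phi>2"
    and "\<theta>1 = fps_op \<phi>1 pderiv" and "\<theta>2 = fps_op \<phi>2 pderiv"
    and "\<theta>12 = fps_op (\<phi>2 oo \<phi>1) pderiv"
    and "\<eta>1 = fps_op (fps_inv \<phi>1) pderiv" and "\<eta>2 = fps_op (fps_inv \<phi>2) pderiv"
  shows "(\<forall>x. fps_op (fps_exp x) (fps_op (fps_inv \<phi>1) \<eta>2) = exp_exp_op x \<eta>1 \<eta>2)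
    \<and> (\<forall>n. (\<forall>x.
          poly (poweroid \<theta>12 n) x = poly (exp_exp_op x \<eta>1 \<eta>2 (monom 1 n)) 0
        \<and> poly (exp_exp_op x \<eta>1 \<eta>2 (monom 1 n)) 0 = exp_at_0 x \<eta>1 (poweroid \<theta>2 n)
        \<and> exp_at_0 x \<eta>1 (poweroid \<theta>2 n)
            = poly (umbral_subst (poweroid \<theta>2 n) (poweroid \<theta>1)) x)
      \<and> poweroid \<theta>12 n = umbral_subst (poweroid \<theta>2 n) (poweroid \<theta>1))"
proof -
  define \<psi>1 \<psi>2 where "\<psi>1 = fps_inv \<phi>1" and "\<psi>2 = fps_inv \<phi>2"
  have \<phi>: "fps_nth \<phi>1 0 = 0" "fps_nth \<phi>1 1 \<noteq> 0" "fps_nth \<phi>2 0 = 0" "fps_nth \<phi>2 1 \<noteq> 0"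
    using assms(1,2) by (simp_all add: delta_series_def)
  have \<psi>: "fps_nth \<psi>1 0 = 0" "fps_nth \<psi>2 0 = 0"
    by (simp_all add: \<psi>1_def \<psi>2_def fps_inv_def)
  have inv: "\<phi>1 oo \<psi>1 = fps_X" "\<phi>2 oo \<psi>2 = fps_X"
    using \<phi> by (simp_all add: \<psi>1_def \<psi>2_def fps_inv_right)
  have \<psi>12: "fps_nth (\<psi>1 oo \<psi>2) 0 = 0" using \<psi> by simp
  \<comment> \<open>Regrouping brings the inner pair together, so that it cancels first.\<close>
  have "(\<phi>2 oo \<phi>1) oo (\<psi>1 oo \<psi>2) = \<phi>2 oo ((\<phi>1 oo \<psi>1) oo \<psi>2)"
    using \<phi> \<psi> \<psi>12 by (simp add: fps_compose_assoc)
  then have inv12: "(\<phi>2 oo \<phi>1) oo (\<psi>1 oo \<psi>2) = fps_X"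
    using \<psi> inv by (simp add: fps_X_fps_compose_startby0)
  have p1: "poweroid \<theta>1 = explicit_poweroid \<psi>1"
    using poweroid_eq_explicit[OF assms(1) \<psi>(1) inv(1)] assms(3) by simp
  have p12: "poweroid \<theta>12 = explicit_poweroid (\<psi>1 oo \<psi>2)"
    using poweroid_eq_explicit[OF delta_series_compose[OF assms(1,2)] \<psi>12 inv12] assms(5) by simp
  have p2: "poweroid \<theta>2 = explicit_poweroid \<psi>2"
    using poweroid_eq_explicit[OF assms(2) \<psi>(2) inv(2)] assms(4) by simp
  have \<eta>: "\<eta>1 = fps_op \<psi>1 pderiv" "\<eta>2 = fps_op \<psi>2 pderiv"
    using assms(6,7) by (simp_all add: \<psi>1_def \<psi>2_def)
  have ee: "exp_exp_op x \<eta>1 \<eta>2 = fps_op (fps_exp x oo (\<psi>1 oo \<psi>2)) pderiv" for x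
    using exp_exp_op_fps_op_pderiv[OF \<psi>] \<psi> by (simp add: \<eta> fps_compose_assoc)
  have A: "fps_op (fps_exp x) (fps_op (fps_inv \<phi>1) \<eta>2) = exp_exp_op x \<eta>1 \<eta>2" for x
    using \<psi> \<psi>12 unfolding ee by (simp add: \<eta> fps_op_fps_op_pderiv flip: \<psi>1_def)
  \<comment> \<open>Both sides are n! times the n-th coefficient of
    \<open>fps_exp x oo (\<psi>1 oo \<psi>2)\<close>.\<close>
  have B: "poly (poweroid \<theta>12 n) x = poly (exp_exp_op x \<eta>1 \<eta>2 (monom 1 n)) 0" for n x
    by (simp add: p12 ee poly_explicit_poweroid poly_fps_op_pderiv_monom_0)
  \<comment> \<open>The left side weights the i-th coefficient of \<open>h\<close> by i! times the
    i-th coefficient of \<open>fps_exp x oo \<psi>1\<close>, which is the i-th poweroid of \<theta>1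
    at x.\<close>
  have C: "exp_at_0 x \<eta>1 h = poly (umbral_subst h (poweroid \<theta>1)) x" for h x
    by (simp add: \<eta> p1 exp_at_0_fps_op_pderiv[OF \<psi>(1)] poly_fps_op_pderiv_0 umbral_subst_def
        poly_sum poly_explicit_poweroid mult_ac)
  have D: "poweroid \<theta>12 n = umbral_subst (poweroid \<theta>2 n) (poweroid \<theta>1)" for n
  proof (rule poly_eqI)
    fix k
    have "coeff (umbral_subst (poweroid \<theta>2 n) (poweroid \<theta>1)) k =
        (\<Sum>i\<le>degree (poweroid \<theta>2 n). coeff (poweroid \<theta>2 n) i * coeff (poweroid \<theta>1 i) k)"
      by (simp add: umbral_subst_def coeff_sum)
    also have "\<dots> = (\<Sum>i\<le>n. coeff (poweroid \<theta>2 n) i * coeff (poweroid \<theta>1 i) k)"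
      using degree_explicit_poweroid[of \<psi>2 n]
      by (intro sum.mono_neutral_left) (auto simp: p2 coeff_eq_0)
    \<comment> \<open>The factors i! of the two coefficients cancel, and the remaining sum over i is
      the n-th coefficient of a composition.\<close>
    also have "\<dots> = fact n / fact k * fps_nth (\<psi>1 ^ k oo \<psi>2) n"
      by (simp add: p1 p2 coeff_explicit_poweroid \<psi> fps_compose_nth sum_distrib_left
          atLeast0AtMost mult_ac)
    also have "\<dots> = coeff (poweroid \<theta>12 n) k"
      by (simp add: p12 coeff_explicit_poweroid[OF \<psi>12] fps_compose_power[OF \<psi>(2)])
    finally show "coeff (poweroid \<theta>12 n) k =
        coeff (umbral_subst (poweroid \<theta>2 n) (poweroid \<theta>1)) k" by simp
  qed
  \<comment> \<open>The middle equality of the chain follows by passing from \<open>B\<close>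
    through \<open>D\<close> to \<open>C\<close>.\<close>
  show ?thesis using A B C D by metis
qed

end
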